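(* Let $C_n$ denote the cycle on $n$ vertices. For every integer $m\geq 3$ there is an integer $N$ such that for all $n\geq N$ the graph $(C_n)^m$ is not $2m$-ordered.
   Context: All graphs are finite simple graphs. $d_G(v,w)$ denotes the distance in $G$ between vertices $v$ and $w$. For a positive integer $p$, the $p$-th power $G^p$ of a graph $G$ is the simple graph with the same vertex set as $G$ in which two distinct vertices $v,w$ are adjacent if and only if $d_G(v,w)\leq p$. A graph $G$ is $k$-ordered if for any sequence $v_1,v_2,\dots,v_k$ of $k$ distinct vertices of $G$ there is a cycle in $G$ (not necessarily Hamiltonian) containing these vertices in the given order, i.e. traversing the cycle from $v_1$ in one of its two directions, one meets $v_1,v_2,\dots,v_k$ in this order before returning to $v_1$. *)

theory Defs
  imports "Graph_Theory.Graph_Theory" "HOL-Library.Sublist"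
begin

text \<open>
  Finite simple graphs are pair digraphs satisfying the locale \<^locale>\<open>pair_graph\<close>
  (finite, loop-free, symmetric arc relation).
\<close>

text \<open>
  Every arc has cost 1, so this is the least length of a walk; it is \<open>\<infinity>\<close> between
  vertices in different components.
\<close>
definition graph_dist :: "'a pair_pre_digraph \<Rightarrow> 'a \<Rightarrow> 'a \<Rightarrow> ereal" where
  "graph_dist G v w = wf_digraph.\<mu> (with_proj G) (\<lambda>_. 1) v w"

definition graph_power :: "'a pair_pre_digraph \<Rightarrow> nat \<Rightarrow> 'a pair_pre_digraph" where
  "graph_power G p =
    \<lparr> pverts = pverts G,
      parcs = {(v, w). v \<in> pverts G \<and> w \<in> pverts G \<and> v \<noteq> w \<and> graph_dist G v w \<le> ereal (real p)} \<rparr>"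

text \<open>
  The cycle on the vertices \<open>0, \<dots>, n - 1\<close>; only meaningful for \<open>n \<ge> 3\<close>.
\<close>
definition cycle_graph :: "nat \<Rightarrow> nat pair_pre_digraph" where
  "cycle_graph n =
    \<lparr> pverts = {..<n},
      parcs = {(i, j). i < n \<and> j < n \<and> (j = (i + 1) mod n \<or> i = (j + 1) mod n)} \<rparr>"

text \<open>
  A cycle is given by its list of consecutive arcs, \<open>map fst c\<close> being the vertices in the order of
  traversal. The library's notion admits the walk \<open>u, v, u\<close> along a single undirected edge, hence the
  bound on the length. The starting point and the direction of \<open>c\<close> are both free; in particular
  \<open>c\<close> can be taken to start at the first vertex of \<open>vs\<close>.
\<close>
definition k_ordered :: "nat \<Rightarrow> 'a pair_pre_digraph \<Rightarrow> bool" where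
  "k_ordered k G \<longleftrightarrow>
    (\<forall>vs. length vs = k \<and> distinct vs \<and> set vs \<subseteq> pverts G \<longrightarrow>
      (\<exists>c. pre_digraph.cycle (with_proj G) c \<and> 3 \<le> length c \<and> subseq vs (map fst c)))"

lemma pair_graph_cycle_graph:
  assumes "3 \<le> n"
  shows "pair_graph (cycle_graph n)"
proof
  fix e assume e: "e \<in> parcs (cycle_graph n)"
  then show "fst e \<in> pverts (cycle_graph n)" "snd e \<in> pverts (cycle_graph n)"
    by (auto simp: cycle_graph_def)
  have "(i + 1) mod n \<noteq> i" if "i < n" for i
    using that assms by (cases "i + 1 = n") auto
  with e show "fst e \<noteq> snd e"
    by (auto simp: cycle_graph_def) metis+
next
  show "finite (pverts (cycle_graph n))" by (simp add: cycle_graph_def)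
  show "finite (parcs (cycle_graph n))"
    by (rule finite_subset[of _ "{..<n} \<times> {..<n}"]) (auto simp: cycle_graph_def)
  show "symmetric (with_proj (cycle_graph n))"
    by (auto simp: symmetric_def arcs_ends_def arc_to_ends_def cycle_graph_def sym_def)
qed

lemma graph_dist_sym:
  assumes "pair_graph G"
  shows "graph_dist G v w = graph_dist G w v"
proof -
  interpret pair_graph G by fact
  have *: "graph_dist G y x \<le> graph_dist G x y" for x y
    unfolding graph_dist_def \<mu>_def
  proof (rule INF_mono)
    fix p assume p: "p \<in> {p. awalk x p y}"
    have "length (rev_path p) = length p" for p :: "('a \<times> 'a) list" by (induction p) auto
    then have "awalk_cost (\<lambda>_. 1) (rev_path p) = awalk_cost (\<lambda>_. 1) p"
      by (simp add: awalk_cost_def sum_list_triv)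
    then show "\<exists>q\<in>{p. awalk y p x}. ereal (awalk_cost (\<lambda>_. 1) q) \<le> ereal (awalk_cost (\<lambda>_. 1) p)"
      using p by (intro bexI[of _ "rev_path p"]) (auto simp: awalk_rev_path)
  qed
  show ?thesis by (rule antisym) (rule *)+
qed

lemma pair_graph_graph_power:
  assumes "pair_graph G"
  shows "pair_graph (graph_power G p)"
proof -
  interpret pair_graph G by fact
  show ?thesis
  proof
    show "finite (pverts (graph_power G p))" by (simp add: graph_power_def)
    show "finite (parcs (graph_power G p))"
      by (rule finite_subset[of _ "pverts G \<times> pverts G"]) (auto simp: graph_power_def)
    show "symmetric (with_proj (graph_power G p))"
      using graph_dist_sym[OF assms]
      by (auto simp: symmetric_def arcs_ends_def arc_to_ends_def graph_power_def sym_def)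
  qed (auto simp: graph_power_def)
qed

end

theory Submission
  imports Defs
begin

text \<open>
  Interleave the blocks \<open>B = {0, \<dots>, m - 1}\<close> and \<open>A = {3m - 1, \<dots>, 4m - 2}\<close>, so that the \<open>2m\<close> segments
  of a cycle through the chosen vertices all run between \<open>A\<close> and \<open>B\<close>. Any \<open>m\<close> consecutive vertices
  on one side together with any \<open>m\<close> consecutive vertices on the other separate \<open>A\<close> from \<open>B\<close>, and as
  there are only \<open>2m\<close> of them, every segment contains exactly one. Apply this to the windows
  \<open>{m, \<dots>, 2m - 1}\<close> and \<open>{2m - 1, \<dots>, 3m - 2}\<close>, each with a window beyond \<open>A\<close>: a segment through
  \<open>2m - 1\<close> contains no other vertex of these windows, so the neighbours of \<open>2m - 1\<close> on the cycle can
  only be \<open>m - 1\<close> and \<open>3m - 1\<close>. For \<open>m \<ge> 3\<close> the order is chosen such that these two are not cyclically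
  consecutive.
\<close>

lemma subseq_indices:
  assumes "subseq xs ys"
  obtains f where "strict_mono_on {..<length xs} f"
    and "\<And>i. i < length xs \<Longrightarrow> f i < length ys \<and> ys ! f i = xs ! i"
proof -
  have "\<exists>f. strict_mono_on {..<length xs} f \<and> (\<forall>i<length xs. f i < length ys \<and> ys ! f i = xs ! i)"
    using assms
  proof induction
    case (list_emb_Nil ys)
    then show ?case by (auto simp: strict_mono_on_def)
  next
    case (list_emb_Cons xs ys y)
    then obtain f where "strict_mono_on {..<length xs} f"
      "\<forall>i<length xs. f i < length ys \<and> ys ! f i = xs ! i" by blast
    then show ?case
      by (intro exI[of _ "\<lambda>i. Suc (f i)"]) (auto simp: strict_mono_on_def)
  next
    case (list_emb_Cons2 x y xs ys)
    then obtain f where "strict_mono_on {..<length xs} f"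
      "\<forall>i<length xs. f i < length ys \<and> ys ! f i = xs ! i" by blast
    then show ?case using list_emb_Cons2.hyps
      by (intro exI[of _ "case_nat 0 (\<lambda>i. Suc (f i))"])
        (auto simp: strict_mono_on_def less_Suc_eq_0_disj split: nat.splits)
  qed
  then show thesis using that by blast
qed

text \<open>
  \<open>u\<close> runs once around a cycle and \<open>f\<close> cuts it into \<open>k\<close> segments. If a set of at most \<open>k\<close> vertices
  meets the interior of every segment, then pigeonhole leaves exactly one of its vertices in each.
\<close>
lemma tight_segment:
  fixes f :: "nat \<Rightarrow> nat" and u :: "nat \<Rightarrow> 'a"
  assumes f: "strict_mono_on {..k} f" and inj: "inj_on u {f 0..<f k}"
    and S: "finite S" "card S \<le> k"
    and meets: "\<And>i. i < k \<Longrightarrow> \<exists>t\<in>{f i<..<f (Suc i)}. u t \<in> S"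
    and s: "s \<in> S"
  obtains i t where "i < k" "t \<in> {f i<..<f (Suc i)}" "u t = s"
    "\<And>t'. t' \<in> {f i<..<f (Suc i)} \<Longrightarrow> u t' \<in> S \<Longrightarrow> t' = t"
proof -
  have mono: "f i \<le> f j" if "i \<le> j" "j \<le> k" for i j
    using strict_mono_on_leD[OF f, of i j] that by auto
  have inside: "t \<in> {f 0..<f k}" if "i < k" "t \<in> {f i<..<f (Suc i)}" for i t
    using mono[of 0 i] mono[of "Suc i" k] that by auto
  have unique: "i = j" if "i < k" "j < k" "t \<in> {f i<..<f (Suc i)}" "t \<in> {f j<..<f (Suc j)}" for i j t
    using mono[of "Suc i" j] mono[of "Suc j" i] that by (cases i j rule: linorder_cases) auto
  obtain g where g: "g i \<in> {f i<..<f (Suc i)}" "u (g i) \<in> S" if "i < k" for i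
    using meets by metis
  have inj_ug: "inj_on (u \<circ> g) {..<k}"
  proof (rule inj_onI)
    fix i j assume ij: "i \<in> {..<k}" "j \<in> {..<k}" "(u \<circ> g) i = (u \<circ> g) j"
    then have "g i = g j" using inj_onD[OF inj, of "g i" "g j"] inside g(1) by auto
    then show "i = j" using unique g(1) ij by (metis lessThan_iff)
  qed
  moreover have sub: "(u \<circ> g) ` {..<k} \<subseteq> S" using g(2) by auto
  ultimately have eq: "(u \<circ> g) ` {..<k} = S"
    using S card_image[OF inj_ug] by (intro card_seteq) auto
  have hit: "t = g i" if "i < k" "t \<in> {f i<..<f (Suc i)}" "u t \<in> S" for i t
  proof -
    from that(3) eq obtain j where j: "j < k" "u t = u (g j)" by auto
    then have "t = g j" using inj_onD[OF inj, of t "g j"] inside g(1) that by blast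
    then show ?thesis using unique[of i j t] that j g(1)[of j] by auto
  qed
  from s eq obtain i where "i < k" "u (g i) = s" by auto
  then show thesis using that[of i "g i"] g hit by blast
qed

text \<open>The first vertex after \<open>a\<close> outside \<open>X\<close> lies in
  \<open>S\<close>; it comes before \<open>b\<close> because \<open>u b\<close> is in neither
  set.\<close>

lemma walk_meets_separator:
  fixes u :: "nat \<Rightarrow> 'a"
  assumes step: "\<And>t. E (u t) (u (Suc t))"
    and sep: "\<And>x y. E x y \<Longrightarrow> x \<in> X \<Longrightarrow> y \<notin> X \<Longrightarrow> y \<in> S"
    and "u a \<in> X" "a < b" "u b \<notin> X" "u b \<notin> S"
  shows "\<exists>t\<in>{a<..<b}. u t \<in> S"
proof (rule ccontr)
  assume none: "\<not> ?thesis"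
  have "u t \<in> X" if "a \<le> t" "t < b" for t
    using that
  proof (induction t rule: dec_induct)
    case (step t)
    then show ?case using none assms(1)[of t] sep[of "u t" "u (Suc t)"] by auto
  qed (use assms in auto)
  then have "u (b - 1) \<in> X" using assms by simp
  then show False using assms(1)[of "b - 1"] sep[of "u (b - 1)" "u b"] assms by simp
qed

text \<open>Circular distance at most \<open>d\<close>. The last two disjuncts are the way round
  through 0, written additively to avoid truncated subtraction.\<close>

definition ring_near :: "nat \<Rightarrow> nat \<Rightarrow> nat \<Rightarrow> nat \<Rightarrow> bool" where
  "ring_near n d i j \<longleftrightarrow> i < n \<and> j < n \<and>
    (i \<le> j + d \<and> j \<le> i + d \<or> i + n \<le> j + d \<or> j + n \<le> i + d)"

lemma ring_near_sym: "ring_near n d i j \<longleftrightarrow> ring_near n d j i"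
  by (auto simp: ring_near_def)

lemma ring_near_step:
  assumes "(i, j) \<in> parcs (cycle_graph n)" "ring_near n d j k"
  shows "ring_near n (Suc d) i k"
proof -
  have *: "(a + 1) mod n = (if a + 1 = n then 0 else a + 1)" if "a < n" for a
    using that by auto
  show ?thesis
    using assms *[of i] *[of j]
    by (auto simp: cycle_graph_def ring_near_def split: if_splits)
qed

lemma graph_power_cycle_near:
  assumes "(i, j) \<in> parcs (graph_power (cycle_graph n) m)"
  shows "ring_near n m i j" "i \<noteq> j"
proof -
  let ?G = "with_proj (cycle_graph n)"
  interpret wf_digraph ?G
    by unfold_locales (auto simp: cycle_graph_def)
  have near: "ring_near n (length p) x y" if "awalk x p y" for x p y
    using that
  proof (induction p arbitrary: x)
    case Nil
    then have "x = y" "x \<in> pverts (cycle_graph n)" by (auto simp: awalk_Nil_iff)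
    then show ?case by (auto simp: ring_near_def cycle_graph_def)
  next
    case (Cons e p)
    then have "e \<in> parcs (cycle_graph n)" "fst e = x" "ring_near n (length p) (snd e) y"
      by (auto simp: awalk_Cons_iff)
    then show ?case using ring_near_step[of x "snd e"] by (cases e) auto
  qed
  show "i \<noteq> j" using assms by (auto simp: graph_power_def)
  have "\<mu> (\<lambda>_. 1) i j \<le> ereal (real m)"
    using assms by (auto simp: graph_power_def graph_dist_def)
  \<comment> \<open>Costs are integers, so if all walks were longer than \<open>m\<close> the
    infimum would be at least \<open>Suc m\<close>; whether it is attained need not be
    discussed.\<close>
  moreover have "ereal (real (Suc m)) \<le> \<mu> (\<lambda>_. 1) i j" if "\<And>p. awalk i p j \<Longrightarrow> Suc m \<le> length p"
    unfolding \<mu>_def using that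
    by (intro INF_greatest) (auto simp: awalk_cost_def sum_list_triv simp del: of_nat_Suc)
  ultimately obtain p where "awalk i p j" "length p \<le> m"
    by (metis (no_types, lifting) not_less_eq_eq of_nat_le_iff order.trans ereal_less_eq(3) Suc_n_not_le_n)
  then show "ring_near n m i j" using near[of i p j] by (auto simp: ring_near_def)
qed

lemma cycle_arc_step:
  assumes "pre_digraph.cycle (with_proj G) c" "k < length c"
  shows "(fst (c ! k), fst (c ! (Suc k mod length c))) \<in> parcs G"
proof -
  have cas_step: "snd (p ! i) = (if Suc i < length p then fst (p ! Suc i) else y)"
    if "pre_digraph.cas (with_proj G) x p y" "i < length p" for x p y i
    using that
  proof (induction p arbitrary: x i)
    case (Cons e p)
    then show ?case
      by (cases i; cases p) (auto simp: pre_digraph.cas.simps)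
  qed simp
  obtain x where x: "pre_digraph.cas (with_proj G) x c x" "set c \<subseteq> parcs G" "c \<noteq> []"
    using assms by (auto simp: pre_digraph.cycle_def pre_digraph.awalk_def)
  then have "x = fst (c ! 0)"
    by (cases c) (auto simp: pre_digraph.cas.simps)
  then have "snd (c ! k) = fst (c ! (Suc k mod length c))"
    using cas_step[OF x(1) assms(2)] assms(2) by (auto simp: mod_Suc)
  moreover have "c ! k \<in> parcs G" using x assms by auto
  ultimately show ?thesis by (metis prod.collapse)
qed

text \<open>A cycle has distinct entries in \<open>tl\<close> of its vertex list; since the walk is
  closed, that list is \<open>map fst c\<close> rotated by one place.\<close>

lemma cycle_distinct_tails:
  assumes "pre_digraph.cycle (with_proj G) c"
  shows "distinct (map fst c)"
proof -
  have verts: "pre_digraph.awalk_verts (with_proj G) x p = map fst p @ [y]"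
    if "pre_digraph.cas (with_proj G) x p y" for x p y
    using that
  proof (induction p arbitrary: x)
    case (Cons e p)
    then show ?case
      by (auto simp: pre_digraph.cas.simps pre_digraph.awalk_verts.simps)
  qed (auto simp: pre_digraph.cas.simps pre_digraph.awalk_verts.simps)
  obtain x where x: "pre_digraph.cas (with_proj G) x c x" "c \<noteq> []"
    "distinct (tl (pre_digraph.awalk_verts (with_proj G) x c))"
    using assms by (auto simp: pre_digraph.cycle_def pre_digraph.awalk_def)
  then show ?thesis
    using verts[OF x(1)] by (cases c) (auto simp: pre_digraph.cas.simps)
qed

text \<open>A step of size at most \<open>m\<close> cannot jump over \<open>m\<close> consecutive
  vertices. The bounds on \<open>a\<close> and \<open>n\<close> keep steps from this interval from
  passing through 0.\<close>

lemma ring_separator: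
  assumes "ring_near n m x y" "6 * m \<le> n" "m \<le> a" "a \<le> 2 * m - 1" "0 < m"
    and "x \<in> {a + m..<4 * m - 1}" "y \<notin> {a + m..<4 * m - 1}"
  shows "y \<in> {a..<a + m} \<union> {4 * m - 1..<5 * m - 1}"
  using assms by (auto simp: ring_near_def)

theorem proposition6p3:
  fixes m :: nat
  assumes "m \<ge> 3"
  shows "\<exists>N::nat. \<forall>n\<ge>N. \<not> k_ordered (2 * m) (graph_power (cycle_graph n) m)"
proof (intro exI[of _ "6 * m"] allI impI notI)
  fix n assume n: "6 * m \<le> n" and ordered: "k_ordered (2 * m) (graph_power (cycle_graph n) m)"
  \<comment> \<open>The order is 0, 3m-1, 1, 3m, ..., m-1, 4m-2. The critical vertices 3m-1 and m-1
    have the indices 1 and 2m-2.\<close>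
  define v where "v j = (if even j then j div 2 else 3 * m - 1 + j div 2)" for j :: nat
  define A where "A = {3 * m - 1..<4 * m - 1}"
  define B where "B = {..<m}"
  have v_side: "if even j then v j \<in> B else v j \<in> A" if "j < 2 * m" for j
    using that assms by (auto simp: v_def A_def B_def elim!: oddE)
  have "distinct (map v [0..<2 * m])"
    using assms by (auto simp: distinct_map inj_on_def v_def split: if_splits elim!: evenE oddE)
  moreover have "v j < n" if "j < 2 * m" for j
    using v_side[OF that] n assms by (auto simp: A_def B_def split: if_splits)
  then have "set (map v [0..<2 * m]) \<subseteq> pverts (graph_power (cycle_graph n) m)"
    by (auto simp: graph_power_def cycle_graph_def)
  ultimately obtain c where
    c: "pre_digraph.cycle (with_proj (graph_power (cycle_graph n) m)) c" "3 \<le> length c"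
      "subseq (map v [0..<2 * m]) (map fst c)"
    using ordered unfolding k_ordered_def by (metis length_map length_upt minus_nat.diff_0)
  define L where "L = length c"
  define u where "u t = fst (c ! (t mod L))" for t
  have L: "3 \<le> L" using c by (simp add: L_def)
  then have mod_L: "t mod L < L" for t by (intro mod_less_divisor) auto
  have step: "ring_near n m (u t) (u (Suc t))" "u t \<noteq> u (Suc t)" for t
  proof -
    have "(u t, u (Suc t)) \<in> parcs (graph_power (cycle_graph n) m)"
      using cycle_arc_step[OF c(1), of "t mod L"] mod_L[of t]
      by (simp add: u_def L_def mod_Suc_eq)
    then show "ring_near n m (u t) (u (Suc t))" "u t \<noteq> u (Suc t)"
      using graph_power_cycle_near by auto
  qed
  have period: "s + L \<le> t" if "u s = u t" "s < t" for s t
  proof -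
    have "s mod L = t mod L"
      using that nth_eq_iff_index_eq[OF cycle_distinct_tails[OF c(1)], of "s mod L" "t mod L"]
        mod_L[of s] mod_L[of t]
      by (simp add: u_def L_def)
    then have "L dvd t - s" using that by (metis less_imp_le mod_eq_dvd_iff_nat)
    then show ?thesis using that dvd_imp_le[of L "t - s"] by auto
  qed
  obtain f where f: "strict_mono_on {..<2 * m} f"
    "\<And>i. i < 2 * m \<Longrightarrow> f i < length c \<and> map fst c ! f i = v i"
    by (rule subseq_indices[OF c(3)]) auto
  have uf: "f i < L" "u (f i) = v i" if "i < 2 * m" for i
    using f(2)[OF that] by (auto simp: u_def L_def)
  \<comment> \<open>The extra value one period later makes the closing segment, from the last chosen
    vertex back to the first, a segment like the others.\<close>
  define g where "g i = (if i < 2 * m then f i else f 0 + L)" for i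
  have g: "strict_mono_on {..2 * m} g"
    using f(1) uf(1) by (auto simp: strict_mono_on_def g_def intro: trans_less_add2)
  have g_less: "g i < g j" if "i < j" "j \<le> 2 * m" for i j
    using strict_mono_onD[OF g] that by auto
  have g_le: "g i \<le> g j" if "i \<le> j" "j \<le> 2 * m" for i j
    using strict_mono_on_leD[OF g] that by auto
  have ug: "u (g i) = v (if i = 2 * m then 0 else i)" if "i \<le> 2 * m" for i
    using that uf(2)[of i] uf(2)[of 0] assms by (auto simp: g_def u_def)
  have g_end: "g (2 * m) = g 0 + L" using assms by (simp add: g_def)
  have inj: "inj_on u {g 0..<g (2 * m)}"
  proof (rule inj_onI)
    fix s t assume "s \<in> {g 0..<g (2 * m)}" "t \<in> {g 0..<g (2 * m)}" "u s = u t"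
    then show "s = t" using period[of s t] period[of t s] g_end by (cases s t rule: linorder_cases) auto
  qed
  define S where "S a = {a..<a + m} \<union> {4 * m - 1..<5 * m - 1}" for a
  have meets: "\<exists>t\<in>{g i<..<g (Suc i)}. u t \<in> S a" if a: "m \<le> a" "a \<le> 2 * m - 1" and i: "i < 2 * m" for a i
  proof -
    define X where "X = {a + m..<4 * m - 1}"
    have out: "y \<in> S a" if "ring_near n m x y" "x \<in> X" "y \<notin> X" for x y
      using ring_separator[of n m x y a] that a n assms by (auto simp: S_def X_def)
    have AX: "A \<subseteq> X" "A \<inter> S a = {}" "B \<inter> (X \<union> S a) = {}"
      using a assms by (auto simp: A_def B_def X_def S_def)
    have lt: "g i < g (Suc i)" using g_less i by auto
    show ?thesis
    proof (cases "even i")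
      \<comment> \<open>Here the walk enters \<open>X\<close>, so the separator lemma is applied to
        the complement of \<open>X \<union> S a\<close>: an edge from there into \<open>X\<close>
        would, reversed, contradict \<open>out\<close>.\<close>
      case True
      then have "Suc i < 2 * m" using i by presburger
      then have "v i \<in> B" "u (g (Suc i)) \<in> A"
        using True v_side[of i] v_side[of "Suc i"] ug[of "Suc i"] by (auto split: if_splits)
      then show ?thesis
        using AX lt i ug[of i] out ring_near_sym[of n m]
        by (intro walk_meets_separator[where E = "ring_near n m" and X = "- (X \<union> S a)"] step(1)) auto
    next
      case False
      have "v i \<in> A" "u (g (Suc i)) \<in> B"
        using False i v_side[of i] v_side[of "Suc i"] v_side[of 0] ug[of "Suc i"] assms
        by (auto split: if_splits)
      then show ?thesis
        using AX lt i ug[of i] out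
        by (intro walk_meets_separator[where E = "ring_near n m" and X = X] step(1)) auto
    qed
  qed
  have card_S: "card (S a) \<le> 2 * m" "finite (S a)" for a
    unfolding S_def by (rule card_Un_le[THEN order_trans]) auto
  have tight: "\<exists>i t. i < 2 * m \<and> t \<in> {g i<..<g (Suc i)} \<and> u t = 2 * m - 1 \<and>
      (\<forall>t'\<in>{g i<..<g (Suc i)}. u t' \<in> S a \<longrightarrow> t' = t)"
    if "a = m \<or> a = 2 * m - 1" for a
  proof -
    have "2 * m - 1 \<in> S a" "m \<le> a" "a \<le> 2 * m - 1"
      using that assms by (auto simp: S_def)
    then show ?thesis
      using tight_segment[OF g inj card_S(2,1) meets, of a "2 * m - 1"] by metis
  qed
  obtain i k where ik: "i < 2 * m" "k \<in> {g i<..<g (Suc i)}" "u k = 2 * m - 1"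
    and only: "\<And>t. t \<in> {g i<..<g (Suc i)} \<Longrightarrow> u t \<in> S m \<Longrightarrow> t = k"
    using tight[of m] by blast
  obtain j l where jl: "j < 2 * m" "l \<in> {g j<..<g (Suc j)}" "u l = 2 * m - 1"
    and only': "\<And>t. t \<in> {g j<..<g (Suc j)} \<Longrightarrow> u t \<in> S (2 * m - 1) \<Longrightarrow> t = l"
    using tight[of "2 * m - 1"] by blast
  \<comment> \<open>The two windows yield their segments separately. As \<open>2 * m - 1\<close> is
    visited only once per period, the segments coincide, and both uniqueness statements hold in one
    segment.\<close>
  have "k = l"
  proof (rule inj_onD[OF inj])
    show "u k = u l" using ik jl by simp
    show "k \<in> {g 0..<g (2 * m)}" "l \<in> {g 0..<g (2 * m)}"
      using ik jl g_le[of 0 i] g_le[of "Suc i" "2 * m"] g_le[of 0 j] g_le[of "Suc j" "2 * m"] by auto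
  qed
  moreover have "i = j"
    using ik(1,2) jl(1,2) \<open>k = l\<close> g_le[of "Suc i" j] g_le[of "Suc j" i]
    by (cases i j rule: linorder_cases) auto
  ultimately have only2: "t = k" if "t \<in> {g i<..<g (Suc i)}" "u t \<in> S m \<union> S (2 * m - 1)" for t
    using only only' that by blast
  have neighbour: "t = g 1 \<or> t = g (2 * m - 2)" if t: "Suc t = k \<or> t = Suc k" for t
  proof -
    have t_seg: "g i \<le> t" "t \<le> g (Suc i)" using t ik by auto
    have near: "ring_near n m (u t) (2 * m - 1)" "u t \<noteq> 2 * m - 1"
      using t step[of t] step[of k] ik(3) ring_near_sym[of n m] by auto
    have range: "m - 1 \<le> u t" "u t \<le> 3 * m - 1"
      using near n assms by (auto simp: ring_near_def)
    \<comment> \<open>The two windows fill m, ..., 3m-2, so an interior \<open>t\<close> is left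
      with the two ends of the range. If \<open>t\<close> is an end of the segment,
      \<open>A \<union> B\<close> meets the range in just these two.\<close>
    have "u t = m - 1 \<or> u t = 3 * m - 1"
    proof (cases "t \<in> {g i<..<g (Suc i)}")
      case True
      then have "u t \<notin> S m \<union> S (2 * m - 1)" using only2[of t] t by auto
      then show ?thesis using range near(2) by (auto simp: S_def)
    next
      case False
      then have "t = g i \<or> t = g (Suc i)" using t_seg by auto
      then have "u t \<in> A \<union> B"
        using ug[of i] ug[of "Suc i"] v_side[of i] v_side[of "Suc i"] v_side[of 0] ik(1) assms
        by (auto split: if_splits)
      then show ?thesis using range by (auto simp: A_def B_def)
    qed
    moreover have "2 * m - 2 = 2 * (m - 1)" by simp
    then have "v (2 * m - 2) = m - 1" "v 1 = 3 * m - 1" by (simp_all only: v_def) simp_all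
    then have "u (g 1) = 3 * m - 1" "u (g (2 * m - 2)) = m - 1"
      using ug[of 1] ug[of "2 * m - 2"] assms by auto
    ultimately obtain p where p: "p = 1 \<or> p = 2 * m - 2" "u t = u (g p)"
      by metis
    \<comment> \<open>Strictness matters: \<open>g p\<close> is interior to the period and
      \<open>t\<close> lies in the closed period, so they differ by less than \<open>L\<close> and
      equal vertices force equal times.\<close>
    have "g 0 < g p" "g p < g 0 + L"
      using g_less[of 0 p] g_less[of p "2 * m"] p assms g_end by auto
    moreover have "g 0 \<le> t" "t \<le> g 0 + L"
      using t_seg g_le[of 0 i] g_le[of "Suc i" "2 * m"] ik(1) g_end by auto
    ultimately have "t = g p"
      using period[of t "g p"] period[of "g p" t] p(2) by (cases t "g p" rule: linorder_cases) auto
    then show ?thesis using p by auto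
  qed
  have index: "p = i \<or> p = Suc i" if "p \<le> 2 * m" "g i \<le> g p" "g p \<le> g (Suc i)" for p
    using that g_less[of p i] g_less[of "Suc i" p] ik(1) by linarith
  obtain p where p: "p = 1 \<or> p = 2 * m - 2" "k - 1 = g p"
    using neighbour[of "k - 1"] ik(2) by auto
  obtain q where q: "q = 1 \<or> q = 2 * m - 2" "Suc k = g q"
    using neighbour[of "Suc k"] by auto
  have "p \<noteq> q" using p(2) q(2) by auto
  \<comment> \<open>Hence 1 and 2m-2 would be the consecutive indices \<open>i\<close> and
    \<open>Suc i\<close>, but 2m-2 is at least 4.\<close>
  moreover have "p = i \<or> p = Suc i" "q = i \<or> q = Suc i"
    using index[of p] index[of q] p q ik(2) assms by auto
  ultimately show False using p(1) q(1) assms by auto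
qed

end
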